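(* Let $M \in \{0,1\}^{n \times n}$ be a binary matrix of twin-width $d$. Then both the row-Hamming-coherence and the column-Hamming-coherence of $M$ satisfy $\mathscr{H}^r(M), \mathscr{H}^c(M) \in 2^{2^{\mathcal{O}(d)}} \cdot n \log n$.
   Context: The Hamming distance of $u,v\in\{0,1\}^n$ is $d(u,v)=\sum_{i=1}^n|u_i-v_i|$. Let $r^{(1)},\dots,r^{(n)}$ be the rows of $M$. For a permutation $\pi$ of $[n]$, the row-Hamming-sum is $\mathscr{H}^r_\pi(M)=\sum_{i=1}^{n-1} d(r^{(\pi(i))},r^{(\pi(i+1))})$, and the row-Hamming-coherence is $\mathscr{H}^r(M)=\min_\pi \mathscr{H}^r_\pi(M)$. The column-Hamming-sum and column-Hamming-coherence $\mathscr{H}^c(M)$ are defined analogously using the columns. Twin-width. A division of an $n\times n$ matrix $M$ is a pair $(\mathcal{R},\mathscr{C})$ of partitions of $[n]$ into contiguous non-empty intervals; the cell $(i,j)$ is the submatrix with rows in the $i$-th interval of $\mathcal{R}$ and columns in the $j$-th interval of $\mathscr{C}$; a cell is constant if all its entries are equal. A row (resp. column) of the division is the set of cells sharing a given interval of $\mathcal{R}$ (resp. $\mathscr{C}$). A merge sequence is a sequence of divisions $(\mathcal{R}_{2n-1},\mathscr{C}_{2n-1}),\dots,(\mathcal{R}_1,\mathscr{C}_1)$ starting from the singleton partitions, ending with $\mathcal{R}_1=\mathscr{C}_1=\{[n]\}$, each obtained from the previous by merging two adjacent intervals of either the row or the column partition. It is $d$-wide if in every division every row and every column contains at most $d$ non-constant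 cells. $M$ is $d$-twin-ordered if it admits a $d$-wide merge sequence; the twin-width of $M$ is the least $d$ such that some permutation of the rows and of the columns of $M$ is $d$-twin-ordered. *)

theory Defs
  imports "HOL-Combinatorics.Permutations" Complex_Main
begin

text \<open>An n x n binary matrix is a function nat => nat => bool; only entries with
  indices in {0..<n} are relevant (indices are 0-based).\<close>

type_synonym bmatrix = "nat \<Rightarrow> nat \<Rightarrow> bool"

definition hamming_rows :: "nat \<Rightarrow> bmatrix \<Rightarrow> nat \<Rightarrow> nat \<Rightarrow> nat" where
  "hamming_rows n M i j = card {k. k < n \<and> M i k \<noteq> M j k}"

definition row_hamming_sum :: "nat \<Rightarrow> bmatrix \<Rightarrow> (nat \<Rightarrow> nat) \<Rightarrow> nat" where
  "row_hamming_sum n M \<pi> = (\<Sum>i<n - 1. hamming_rows n M (\<pi> i) (\<pi> (i + 1)))"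

definition row_hamming_coherence :: "nat \<Rightarrow> bmatrix \<Rightarrow> nat" where
  "row_hamming_coherence n M = Min {row_hamming_sum n M \<pi> | \<pi>. \<pi> permutes {0..<n}}"

definition transp_mat :: "bmatrix \<Rightarrow> bmatrix" where
  "transp_mat M = (\<lambda>i j. M j i)"

definition col_hamming_coherence :: "nat \<Rightarrow> bmatrix \<Rightarrow> nat" where
  "col_hamming_coherence n M = row_hamming_coherence n (transp_mat M)"

text \<open>Twin-width. A partition of [n] into contiguous intervals is a set of sets of indices.\<close>

type_synonym division = "nat set set \<times> nat set set"

definition singletons :: "nat \<Rightarrow> nat set set" where
  "singletons n = {{i} | i. i < n}"

definition merge_adj :: "nat set set \<Rightarrow> nat set set \<Rightarrow> bool" where
  "merge_adj P P' \<longleftrightarrow> (\<exists>A B. A \<in> P \<and> B \<in> P \<and> A \<noteq> {} \<and> B \<noteq> {} \<and>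
      Max A + 1 = Min B \<and> P' = (P - {A, B}) \<union> {A \<union> B})"

definition merge_step :: "division \<Rightarrow> division \<Rightarrow> bool" where
  "merge_step D D' \<longleftrightarrow>
     (merge_adj (fst D) (fst D') \<and> snd D' = snd D) \<or>
     (merge_adj (snd D) (snd D') \<and> fst D' = fst D)"

definition constant_cell :: "bmatrix \<Rightarrow> nat set \<Rightarrow> nat set \<Rightarrow> bool" where
  "constant_cell M I J \<longleftrightarrow>
     (\<forall>i\<in>I. \<forall>j\<in>J. \<forall>i'\<in>I. \<forall>j'\<in>J. M i j = M i' j')"

definition d_wide_division :: "nat \<Rightarrow> bmatrix \<Rightarrow> division \<Rightarrow> bool" where
  "d_wide_division d M D \<longleftrightarrow>
     (\<forall>I\<in>fst D. card {J \<in> snd D. \<not> constant_cell M I J} \<le> d) \<and>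
     (\<forall>J\<in>snd D. card {I \<in> fst D. \<not> constant_cell M I J} \<le> d)"

definition merge_sequence :: "nat \<Rightarrow> (nat \<Rightarrow> division) \<Rightarrow> bool" where
  "merge_sequence n s \<longleftrightarrow>
     s 0 = (singletons n, singletons n) \<and>
     s (2 * n - 2) = ({{0..<n}}, {{0..<n}}) \<and>
     (\<forall>k < 2 * n - 2. merge_step (s k) (s (Suc k)))"

definition twin_ordered :: "nat \<Rightarrow> nat \<Rightarrow> bmatrix \<Rightarrow> bool" where
  "twin_ordered d n M \<longleftrightarrow>
     (\<exists>s. merge_sequence n s \<and> (\<forall>k \<le> 2 * n - 2. d_wide_division d M (s k)))"

definition twin_width :: "nat \<Rightarrow> bmatrix \<Rightarrow> nat" where
  "twin_width n M = (LEAST d. \<exists>\<sigma> \<tau>. \<sigma> permutes {0..<n} \<and> \<tau> permutes {0..<n} \<and>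
                              twin_ordered d n (\<lambda>i j. M (\<sigma> i) (\<tau> j)))"

end

theory Submission
  imports Defs
begin

text \<open>
  The heart of the proof is a packing bound: among any m \<ge> 2 rows of a d-twin-ordered matrix, two
  have Hamming distance at most C n / m, where C depends only on d. Given this, build a Hamiltonian
  path greedily: take a closest pair a, b, remove a, order the remaining rows, and
  reinsert a next to b at extra cost at most twice their distance. The costs add up to a
  harmonic sum.

  For the packing bound, let the rows of a set S be pairwise at distance more than \<delta>. All columns
  start out light. Follow the merge sequence up to the first moment at which a column part J contains
  two heavy columns or at least \<tau> = \<delta> / (d + 1) light ones. Just before, the rows of S inside one
  row part are told apart by the at most d heavy columns in its non-constant cells, since the light
  columns there are too few; so every row part meets S in at most 2^d rows. Deleting the at most
  d 2^d rows that lie in non-constant cells of J makes all columns of J equal on S, so that J may be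
  replaced by a single heavy column, and the argument restarts with a fresh run of the sequence.
  This happens O(n / \<tau>) times before the whole sequence runs through, and then at most 2^d rows are
  left.
\<close>

section \<open>Divisions in a merge sequence\<close>

lemma Union_merge_adj: "merge_adj P P' \<Longrightarrow> \<Union>P' = \<Union>P"
  unfolding merge_adj_def by blast

lemma merge_sequence_Union:
  assumes "merge_sequence n s" "k \<le> 2 * n - 2"
  shows "\<Union>(fst (s k)) = {0..<n} \<and> \<Union>(snd (s k)) = {0..<n}"
  using assms(2)
proof (induction k)
  case 0
  have "\<Union>(singletons n) = {0..<n}" 
  proof -
    have "singletons n = (\<lambda>i. {i}) ` {0..<n}" by (auto simp: singletons_def)
    then show ?thesis by simp
  qed
  then show ?case using assms(1) by (simp add: merge_sequence_def)
next
  case (Suc k)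
  then have "merge_step (s k) (s (Suc k))"
    using assms(1) by (auto simp: merge_sequence_def)
  then show ?case
    using Suc Union_merge_adj unfolding merge_step_def by (metis Suc_leD)
qed

lemma finite_of_Union_eq: "\<Union>P = {0..<n} \<Longrightarrow> finite (P :: nat set set)"
  by (metis finite_UnionD finite_atLeastLessThan)

text \<open>Width treats rows and columns alike, so swapping the two partitions in every division
  works. This reduces the column bound to the row bound.\<close>

lemma twin_ordered_transp:
  assumes "twin_ordered d n M"
  shows "twin_ordered d n (transp_mat M)"
proof -
  obtain s where s: "merge_sequence n s" "\<forall>k\<le>2 * n - 2. d_wide_division d M (s k)"
    using assms unfolding twin_ordered_def by blast
  have "constant_cell (transp_mat M) I J \<longleftrightarrow> constant_cell M J I" for I J
    unfolding constant_cell_def transp_mat_def by blast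
  then have "d_wide_division d (transp_mat M) (prod.swap D) \<longleftrightarrow> d_wide_division d M D" for D
    unfolding d_wide_division_def by auto
  moreover have "merge_sequence n (prod.swap \<circ> s)"
    using s(1) unfolding merge_sequence_def merge_step_def by auto
  ultimately show ?thesis
    using s(2) unfolding twin_ordered_def by (intro exI[of _ "prod.swap \<circ> s"]) auto
qed

text \<open>The partition after \<open>k\<close> merges when the first interval absorbs one index at
  a time.\<close>

definition initial_block :: "nat \<Rightarrow> nat \<Rightarrow> nat set set" where
  "initial_block n k = insert {0..<Suc k} {{i} | i. k < i \<and> i < n}"

lemma merge_adj_initial_block:
  assumes "Suc k < n"
  shows "merge_adj (initial_block n k) (initial_block n (Suc k))"
proof -
  have "Max {0..<Suc k} = k"
    by (intro Max_eqI) auto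
  moreover have "initial_block n (Suc k)
      = (initial_block n k - {{0..<Suc k}, {Suc k}}) \<union> {{0..<Suc k} \<union> {Suc k}}"
  proof -
    have "{0..<Suc k} \<union> {Suc k} = {0..<Suc (Suc k)}" by auto
    moreover have "{i} \<noteq> {0..<Suc k}" if "k < i" for i using that by auto
    ultimately show ?thesis
      unfolding initial_block_def by auto
  qed
  ultimately show ?thesis
    unfolding merge_adj_def using assms
    by (intro exI[of _ "{0..<Suc k}"] exI[of _ "{Suc k}"]) (auto simp: initial_block_def)
qed

text \<open>All row merges come first, then all column merges: \<open>min\<close> freezes the rows
  after step \<open>n - 1\<close>, and truncated subtraction keeps the columns as singletons until
  then.\<close>

lemma merge_sequence_exists:
  assumes "n \<ge> 1"
  shows "\<exists>s. merge_sequence n s"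
proof -
  define s where "s k = (initial_block n (min k (n - 1)), initial_block n (k - (n - 1)))" for k
  have first: "initial_block n 0 = singletons n"
    using assms unfolding initial_block_def singletons_def by (auto; metis gr0I)
  have last: "initial_block n (n - 1) = {{0..<n}}"
    using assms unfolding initial_block_def by auto
  have "merge_step (s k) (s (Suc k))" if "k < 2 * n - 2" for k
  proof (cases "k < n - 1")
    case True
    then show ?thesis
      using merge_adj_initial_block[of k n] by (auto simp: merge_step_def s_def)
  next
    case False
    then have "Suc k - (n - 1) = Suc (k - (n - 1))" "Suc (k - (n - 1)) < n"
      using that by auto
    then show ?thesis
      using False merge_adj_initial_block[of "k - (n - 1)" n] by (auto simp: merge_step_def s_def)
  qed
  moreover have "s (2 * n - 2) = ({{0..<n}}, {{0..<n}})"
  proof -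
    have "min (2 * n - 2) (n - 1) = n - 1" "2 * n - 2 - (n - 1) = n - 1" by auto
    then show ?thesis using last by (simp add: s_def)
  qed
  ultimately show ?thesis
    using first unfolding merge_sequence_def by (intro exI[of _ s]) (auto simp: s_def)
qed

text \<open>Makes the \<open>LEAST\<close> in \<open>twin_width\<close> range over a nonempty set.
  The crude width \<open>2 ^ n\<close> suffices, since all parts are subsets of
  \<open>{0..<n}\<close>.\<close>

lemma twin_ordered_trivial:
  assumes "n \<ge> 1"
  shows "\<exists>d. twin_ordered d n M"
proof -
  obtain s where s: "merge_sequence n s" using merge_sequence_exists[OF assms] by blast
  have card_le: "card {J \<in> P. Q J} \<le> 2 ^ n" if "\<Union>P = {0..<n}" for P :: "nat set set" and Q
  proof -
    have "card {J \<in> P. Q J} \<le> card (Pow {0..<n})"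
      using that by (intro card_mono) auto
    then show ?thesis by (simp add: card_Pow)
  qed
  have "d_wide_division (2 ^ n) M (s k)" if "k \<le> 2 * n - 2" for k
    using merge_sequence_Union[OF s that] card_le[of "fst (s k)"] card_le[of "snd (s k)"]
    by (simp add: d_wide_division_def)
  then show ?thesis using s unfolding twin_ordered_def by blast
qed

lemma twin_width_attained:
  assumes "n \<ge> 1"
  obtains \<sigma> \<tau> where "\<sigma> permutes {0..<n}" "\<tau> permutes {0..<n}"
    "twin_ordered (twin_width n M) n (\<lambda>i j. M (\<sigma> i) (\<tau> j))"
proof -
  obtain d where "twin_ordered d n M" using twin_ordered_trivial[OF assms] by blast
  then have "\<exists>d \<sigma> \<tau>. \<sigma> permutes {0..<n} \<and> \<tau> permutes {0..<n} \<and>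
      twin_ordered d n (\<lambda>i j. M (\<sigma> i) (\<tau> j))"
    by (intro exI[of _ d] exI[of _ id]) simp
  from LeastI_ex[OF this] show ?thesis
    using that unfolding twin_width_def by blast
qed

section \<open>The packing bound\<close>

text \<open>A heavy column in \<open>H\<close> stands for a collapsed block of columns, so one
  disagreement there is enough; light columns in \<open>L\<close> are counted one by one. For empty
  \<open>H\<close> this says that distances on \<open>L\<close> exceed \<delta>.\<close>

definition separated ::
  "bmatrix \<Rightarrow> real \<Rightarrow> nat set \<Rightarrow> nat set \<Rightarrow> nat set \<Rightarrow> bool" where
  "separated M \<delta> H L S \<longleftrightarrow> (\<forall>i\<in>S. \<forall>i'\<in>S. i \<noteq> i' \<longrightarrow>
     (\<exists>h\<in>H. M i h \<noteq> M i' h) \<or> \<delta> < real (card {j \<in> L. M i j \<noteq> M i' j}))"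

text \<open>Such a block is worth collapsing: for finite sets and positive \<tau>, replacing it by a
  single heavy column lowers the potential \<open>2 * card L / \<tau> + card H\<close> by at least
  1.\<close>

definition crowded :: "real \<Rightarrow> nat set \<Rightarrow> nat set \<Rightarrow> nat set \<Rightarrow> bool" where
  "crowded \<tau> H L J \<longleftrightarrow> 2 \<le> card (J \<inter> H) \<or> \<tau> \<le> real (card (J \<inter> L))"

text \<open>Two rows of \<open>R\<close> can differ only in the at most \<open>d\<close>
  non-constant cells. These hold at most \<open>d * \<tau> \<le> \<delta>\<close> light columns, too
  few to separate, and at most one heavy column each. So the rows of \<open>S\<close> in
  \<open>R\<close> have distinct patterns on at most \<open>d\<close> heavy columns.\<close>

lemma card_row_part_le:
  assumes wide: "card {J \<in> P. \<not> constant_cell M R J} \<le> d"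
    and P: "\<Union>P = {0..<n}"
    and sub: "H \<subseteq> {0..<n}" "L \<subseteq> {0..<n}"
    and sep: "separated M \<delta> H L S"
    and uncrowded: "\<And>J. J \<in> P \<Longrightarrow> \<not> crowded \<tau> H L J"
    and \<tau>: "0 < \<tau>" "real d * \<tau> \<le> \<delta>"
  shows "card (R \<inter> S) \<le> 2 ^ d"
proof -
  define N where "N = {J \<in> P. \<not> constant_cell M R J}"
  have finN: "finite N" using finite_of_Union_eq[OF P] by (simp add: N_def)
  have finH: "finite H" and finL: "finite L" using sub finite_subset by blast+
  have cardN: "card N \<le> d" using wide by (simp add: N_def)
  have in_N: "j \<in> \<Union>N" if "i \<in> R" "i' \<in> R" "M i j \<noteq> M i' j" "j < n" for i i' j
  proof -
    obtain J where "J \<in> P" "j \<in> J" using P \<open>j < n\<close> by (metis UnionE atLeastLessThan_iff le0)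
    moreover have "\<not> constant_cell M R J"
      using that \<open>j \<in> J\<close> unfolding constant_cell_def by blast
    ultimately show ?thesis by (auto simp: N_def)
  qed
  define X where "X = H \<inter> \<Union>N"
  have "card X = card (\<Union>J\<in>N. J \<inter> H)"
    unfolding X_def by (rule arg_cong[where f = card]) auto
  also have "\<dots> \<le> (\<Sum>J\<in>N. card (J \<inter> H))" by (rule card_UN_le[OF finN])
  also have "\<dots> \<le> (\<Sum>J\<in>N. 1)"
  proof (rule sum_mono)
    fix J assume "J \<in> N"
    then show "card (J \<inter> H) \<le> 1" using uncrowded[of J] by (auto simp: N_def crowded_def)
  qed
  also have "\<dots> \<le> d" using cardN by simp
  finally have cardX: "card X \<le> d" .
  have "inj_on (\<lambda>i. {h \<in> X. M i h}) (R \<inter> S)"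
  proof (rule inj_onI, rule ccontr)
    fix i i' assume i: "i \<in> R \<inter> S" "i' \<in> R \<inter> S" "i \<noteq> i'"
      and eq: "{h \<in> X. M i h} = {h \<in> X. M i' h}"
    define D where "D = {j \<in> L. M i j \<noteq> M i' j}"
    have "M i h = M i' h" if "h \<in> H" for h
    proof (rule ccontr)
      assume ne: "M i h \<noteq> M i' h"
      have "h < n" using that sub by auto
      then have "h \<in> X" using in_N[of i i' h] i ne that by (auto simp: X_def)
      then show False using eq ne by blast
    qed
    then have "\<delta> < card D"
      using sep i unfolding separated_def D_def by blast
    have "D \<subseteq> (\<Union>J\<in>N. J \<inter> L)"
    proof
      fix j assume "j \<in> D"
      then show "j \<in> (\<Union>J\<in>N. J \<inter> L)"
        using in_N[of i i' j] i sub by (auto simp: D_def)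
    qed
    then have "card D \<le> card (\<Union>J\<in>N. J \<inter> L)"
      using finN finL by (intro card_mono) auto
    also have "\<dots> \<le> (\<Sum>J\<in>N. card (J \<inter> L))" by (rule card_UN_le[OF finN])
    finally have "real (card D) \<le> (\<Sum>J\<in>N. real (card (J \<inter> L)))"
      by (metis of_nat_le_iff of_nat_sum)
    also have "\<dots> \<le> (\<Sum>J\<in>N. \<tau>)"
    proof (rule sum_mono)
      fix J assume "J \<in> N"
      then show "real (card (J \<inter> L)) \<le> \<tau>" using uncrowded[of J] by (auto simp: N_def crowded_def)
    qed
    also have "\<dots> \<le> real d * \<tau>" using cardN \<tau> by simp
    finally show False using \<open>\<delta> < card D\<close> \<tau> by simp
  qed
  moreover have "(\<lambda>i. {h \<in> X. M i h}) ` (R \<inter> S) \<subseteq> Pow X" by auto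
  moreover have finX: "finite X" using finH by (simp add: X_def)
  ultimately have "card (R \<inter> S) \<le> card (Pow X)" by (intro card_inj_on_le) auto
  also have "\<dots> \<le> 2 ^ d" using finX cardX by (simp add: card_Pow)
  finally show ?thesis .
qed

text \<open>Rows that differ at \<open>x\<close> are separated by the new heavy column; rows that
  agree at \<open>x\<close> agree on all of \<open>J\<close>, so what separated them lies outside
  \<open>J\<close>.\<close>

lemma separated_collapse:
  assumes "separated M \<delta> H L S" "x \<in> J" "S' \<subseteq> S"
    and const: "\<And>i j. i \<in> S' \<Longrightarrow> j \<in> J \<Longrightarrow> M i j = M i x"
  shows "separated M \<delta> (insert x (H - J)) (L - J) S'"
  unfolding separated_def
proof (intro ballI impI)
  fix i i' assume i: "i \<in> S'" "i' \<in> S'" "i \<noteq> i'"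
  show "(\<exists>h\<in>insert x (H - J). M i h \<noteq> M i' h) \<or>
      \<delta> < real (card {j \<in> L - J. M i j \<noteq> M i' j})"
  proof (cases "M i x = M i' x")
    case True
    then have "M i j = M i' j" if "j \<in> J" for j using const i that by blast
    then have "{j \<in> L - J. M i j \<noteq> M i' j} = {j \<in> L. M i j \<noteq> M i' j}"
      and "h \<in> H \<Longrightarrow> M i h \<noteq> M i' h \<Longrightarrow> h \<in> H - J" for h by auto
    then show ?thesis using assms(1,3) i unfolding separated_def by (metis insertCI subsetD)
  qed auto
qed

text \<open>Losing at least \<tau> light columns frees 2 units of potential, and the new heavy
  column takes back at most 1.\<close>

lemma card_collapse_light:
  assumes "finite L" "\<tau> \<le> real (card (J \<inter> L))" "\<tau> > 0" "finite H"
  shows "2 * real (card (L - J)) / \<tau> + real (card (insert x (H - J)))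
      \<le> 2 * real (card L) / \<tau> + real (card H) - 1"
proof -
  have "card L = card (L - J) + card (J \<inter> L)"
    using assms(1) by (metis Int_commute card_Int_Diff add.commute)
  then have "real (card (L - J)) \<le> real (card L) - \<tau>" using assms(2) by simp
  then have "2 * real (card (L - J)) / \<tau> \<le> (2 * real (card L) - 2 * \<tau>) / \<tau>"
    using assms(3) by (intro divide_right_mono) auto
  also have "\<dots> = 2 * real (card L) / \<tau> - 2"
    using assms(3) by (simp add: field_simps)
  finally have "2 * real (card (L - J)) / \<tau> \<le> 2 * real (card L) / \<tau> - 2" .
  moreover have "card (insert x (H - J)) \<le> Suc (card H)"
    using assms(4) card_mono[of H "H - J"] by (simp add: card_insert_if)
  ultimately show ?thesis by simp
qed

lemma card_collapse_heavy:
  assumes "finite H" "2 \<le> card (J \<inter> H)"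
  shows "Suc (card (insert x (H - J))) \<le> card H"
proof -
  have "card H = card (H - J) + card (J \<inter> H)"
    using assms(1) by (metis Int_commute card_Int_Diff add.commute)
  then show ?thesis using assms by (simp add: card_insert_if)
qed

text \<open>Each collapse deletes at most \<open>d * 2 ^ d\<close> rows and lowers the potential in
  the bound by at least 1. The induction measure is that potential at \<tau> = 1, a natural
  number.\<close>

lemma card_separated_le:
  assumes seq: "merge_sequence n s"
    and wide: "\<And>k. k \<le> 2 * n - 2 \<Longrightarrow> d_wide_division d M (s k)"
    and \<tau>: "1 < \<tau>" "real d * \<tau> \<le> \<delta>"
    and "H \<subseteq> {0..<n}" "L \<subseteq> {0..<n}" "S \<subseteq> {0..<n}" "separated M \<delta> H L S"
  shows "real (card S) \<le> 2 ^ d + real d * 2 ^ d * (2 * real (card L) / \<tau> + real (card H))"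
  using assms(5-)
proof (induction "2 * card L + card H" arbitrary: H L S rule: less_induct)
  case less
  note sub = \<open>H \<subseteq> {0..<n}\<close> \<open>L \<subseteq> {0..<n}\<close> \<open>S \<subseteq> {0..<n}\<close>
  have fin: "finite H" "finite L" "finite S" using sub finite_subset by blast+
  define bad where "bad k \<longleftrightarrow> k \<le> 2 * n - 2 \<and> (\<exists>J\<in>snd (s k). crowded \<tau> H L J)" for k
  have part: "card (R \<inter> S) \<le> 2 ^ d" if "k \<le> 2 * n - 2" "\<not> bad k" "R \<in> fst (s k)" for k R
  proof (rule card_row_part_le)
    show "card {J \<in> snd (s k). \<not> constant_cell M R J} \<le> d"
      using wide[OF that(1)] that(3) unfolding d_wide_division_def by blast
    show "\<Union>(snd (s k)) = {0..<n}" using merge_sequence_Union[OF seq that(1)] by simp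
    show "\<And>J. J \<in> snd (s k) \<Longrightarrow> \<not> crowded \<tau> H L J" using that by (auto simp: bad_def)
  qed (use less.prems \<tau> in auto)
  show ?case
  proof (cases "\<exists>k. bad k")
    case False
    \<comment> \<open>The final division has a single row part, so the bound for row parts bounds
      \<open>S\<close> itself.\<close>
    have "{0..<n} \<in> fst (s (2 * n - 2))" using seq by (simp add: merge_sequence_def)
    then have "card ({0..<n} \<inter> S) \<le> 2 ^ d" using part False by blast
    then have "real (card S) \<le> 2 ^ d"
      using sub by (simp add: Int_absorb1 flip: of_nat_le_iff)
    also have "\<dots> \<le> 2 ^ d + real d * 2 ^ d * (2 * real (card L) / \<tau> + real (card H))"
      using \<tau> by simp
    finally show ?thesis .
  next
    case True
    define k where "k = (LEAST k. bad k)"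
    have before: "\<not> bad l" if "l < k" for l
      using not_less_Least that unfolding k_def by blast
    have k: "bad k" using LeastI_ex[OF True] by (simp add: k_def)
    then have k_le: "k \<le> 2 * n - 2" by (simp add: bad_def)
    obtain J where J: "J \<in> snd (s k)" "crowded \<tau> H L J" using k by (auto simp: bad_def)
    \<comment> \<open>A singleton meets \<open>H\<close> and \<open>L\<close> in at most one column
      each, and \<tau> > 1; hence a preceding division exists.\<close>
    have "k \<noteq> 0"
    proof
      assume "k = 0"
      then have "J \<in> singletons n" using J seq by (simp add: merge_sequence_def)
      then obtain i where "J = {i}" by (auto simp: singletons_def)
      then have "card (J \<inter> A) \<le> 1" for A 
        using card_mono[of J "J \<inter> A"] by simp
      from this[of H] this[of L] show False using J(2) \<tau> by (simp add: crowded_def)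
    qed
    then obtain l where l: "k = Suc l" using not0_implies_Suc by blast
    have "\<not> bad l" "l \<le> 2 * n - 2" using before l k_le by auto
    \<comment> \<open>Crowding first appears at \<open>k\<close>, so the last merge was of columns.
      The row parts are those of \<open>s l\<close>, where the \<open>2 ^ d\<close> bound
      applies.\<close>
    have "merge_step (s l) (s k)" using seq l k_le by (simp add: merge_sequence_def)
    moreover have "snd (s k) \<noteq> snd (s l)"
      using J \<open>\<not> bad l\<close> \<open>l \<le> 2 * n - 2\<close> by (auto simp: bad_def)
    ultimately have rows: "fst (s k) = fst (s l)" by (auto simp: merge_step_def)
    define N where "N = {R \<in> fst (s k). \<not> constant_cell M R J}"
    \<comment> \<open>Every row of \<open>S\<close> outside \<open>T\<close> is constant along
      \<open>J\<close>, which allows \<open>J\<close> to be collapsed to one of its columns.\<close>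
    define T where "T = (\<Union>R\<in>N. R \<inter> S)"
    have cover: "\<Union>(fst (s k)) = {0..<n}" "\<Union>(snd (s k)) = {0..<n}"
      using merge_sequence_Union[OF seq k_le] by auto
    have finN: "finite N" using finite_of_Union_eq[OF cover(1)] by (simp add: N_def)
    have "card N \<le> d"
      using wide[OF k_le] J(1) unfolding d_wide_division_def N_def by blast
    have "card T \<le> (\<Sum>R\<in>N. card (R \<inter> S))" unfolding T_def by (rule card_UN_le[OF finN])
    also have "\<dots> \<le> (\<Sum>R\<in>N. 2 ^ d)"
      using part[OF \<open>l \<le> 2 * n - 2\<close> \<open>\<not> bad l\<close>] rows by (intro sum_mono) (auto simp: N_def)
    also have "\<dots> \<le> d * 2 ^ d" using \<open>card N \<le> d\<close> by simp
    finally have "card T \<le> d * 2 ^ d" .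
    have "J \<inter> H \<noteq> {} \<or> J \<inter> L \<noteq> {}" using J(2) \<tau> by (auto simp: crowded_def)
    then obtain x where x: "x \<in> J" by blast
    have J_sub: "J \<subseteq> {0..<n}" using J(1) cover by blast
    have const: "M i j = M i x" if "i \<in> S - T" "j \<in> J" for i j
    proof -
      have "i \<in> {0..<n}" using that(1) sub(3) by blast
      then have "i \<in> \<Union>(fst (s k))" unfolding cover(1) .
      then obtain R where R: "R \<in> fst (s k)" "i \<in> R" by (rule UnionE)
      then have "R \<notin> N" using that by (auto simp: T_def)
      then have "constant_cell M R J" using R by (simp add: N_def)
      then show ?thesis using R that x unfolding constant_cell_def by blast
    qed
    define H' L' where "H' = insert x (H - J)" and "L' = L - J"
    have sep: "separated M \<delta> H' L' (S - T)"
      unfolding H'_def L'_def by (rule separated_collapse[OF less.prems(4) x _ const]) auto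
    have "card L' \<le> card L" using fin by (auto simp: L'_def intro: card_mono)
    have decrease: "2 * card L' + card H' < 2 * card L + card H \<and>
      2 * real (card L') / \<tau> + real (card H') \<le> 2 * real (card L) / \<tau> + real (card H) - 1"
    proof (cases "2 \<le> card (J \<inter> H)")
      case True
      then have "Suc (card H') \<le> card H"
        using card_collapse_heavy[OF fin(1)] by (simp add: H'_def)
      moreover have "2 * real (card L') / \<tau> \<le> 2 * real (card L) / \<tau>"
        using \<open>card L' \<le> card L\<close> \<tau> by (intro divide_right_mono) auto
      ultimately show ?thesis using \<open>card L' \<le> card L\<close> by linarith
    next
      case False
      then have light: "\<tau> \<le> real (card (J \<inter> L))" using J(2) by (simp add: crowded_def)
      note card_collapse_light[OF fin(2) light _ fin(1)]
      \<comment> \<open>The instance \<tau> = 1 gives the decrease of the natural-number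
        measure.\<close>
      moreover note card_collapse_light[of L 1 J H x]
      ultimately show ?thesis using light \<tau> fin unfolding H'_def L'_def by simp
    qed
    have "real (card (S - T)) \<le> 2 ^ d + real d * 2 ^ d * (2 * real (card L') / \<tau> + real (card H'))"
    proof (rule less.hyps)
      show "2 * card L' + card H' < 2 * card L + card H" using decrease by blast
      show "H' \<subseteq> {0..<n}" using sub x J_sub by (auto simp: H'_def)
    qed (use sub sep in \<open>auto simp: L'_def\<close>)
    \<comment> \<open>The drop of 1 in the potential pays for the deleted rows
      \<open>T\<close>.\<close>
    also have "\<dots> \<le> 2 ^ d + real d * 2 ^ d * (2 * real (card L) / \<tau> + real (card H) - 1)"
      using decrease by (intro add_left_mono mult_left_mono) auto
    finally have "real (card (S - T))
        \<le> 2 ^ d + real d * 2 ^ d * (2 * real (card L) / \<tau> + real (card H)) - real d * 2 ^ d"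
      by (simp add: algebra_simps)
    moreover have "card S = card (S - T) + card T"
      using fin(3) card_Int_Diff[of S T] by (simp add: T_def Int_absorb1 UN_least add.commute)
    moreover have "real (card T) \<le> real d * 2 ^ d"
      using \<open>card T \<le> d * 2 ^ d\<close> by (metis of_nat_le_iff of_nat_mult of_nat_numeral of_nat_power)
    ultimately show ?thesis by simp
  qed
qed

text \<open>Chosen so that, among m rows with threshold \<delta> = C n / m and \<tau> = \<delta> /
  (d + 1), the collapses account for at most m / 2 rows.\<close>

definition packing_const :: "nat \<Rightarrow> real" where
  "packing_const d = 2 ^ (d + 2) * (real d + 1)\<^sup>2"

text \<open>If all distances exceed \<delta> = C n / m, the collapsing argument started without
  heavy columns gives \<open>m \<le> 2 ^ d + m / 2\<close>. Then
  \<open>m \<le> 2 * 2 ^ d \<le> C\<close>, so \<delta> is at least \<open>n\<close>, which no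
  distance exceeds.\<close>

lemma close_rows_exist:
  assumes ord: "twin_ordered d n M" and S: "S \<subseteq> {0..<n}" "card S \<ge> 2"
  shows "\<exists>i\<in>S. \<exists>i'\<in>S. i \<noteq> i' \<and>
    real (hamming_rows n M i i') \<le> packing_const d * real n / real (card S)"
proof (rule ccontr)
  assume far: "\<not> ?thesis"
  define C m where "C = packing_const d" and "m = real (card S)"
  define \<delta> where "\<delta> = C * real n / m"
  define \<tau> where "\<tau> = \<delta> / (real d + 1)"
  have C: "C = 4 * 2 ^ d * (real d + 1) * (real d + 1)"
    by (simp add: C_def packing_const_def power2_eq_square)
  have Cpos: "C > 0" by (simp add: C)
  have m: "m \<ge> 2" using S(2) by (simp add: m_def)
  have "m \<le> real n"
    using card_mono[OF _ S(1)] by (simp add: m_def)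
  \<comment> \<open>As \<open>m\<close> is at most \<open>n\<close>, \<delta> is at least
    \<open>C\<close>, which exceeds \<open>d + 1\<close>; this yields the required \<tau> >
    1.\<close>
  have "C * m \<le> C * real n" using \<open>m \<le> real n\<close> Cpos by simp
  then have "C \<le> \<delta>" using m by (simp add: \<delta>_def field_simps)
  have "1 * (real d + 1) < (4 * 2 ^ d * (real d + 1)) * (real d + 1)"
  proof (rule mult_strict_right_mono)
    have "1 * 1 \<le> (2 ^ d :: real) * (real d + 1)" by (rule mult_mono) auto
    then show "1 < 4 * 2 ^ d * (real d + 1)" by simp
  qed auto
  then have "real d + 1 < \<delta>" using \<open>C \<le> \<delta>\<close> unfolding C mult_1 by (rule less_le_trans)
  then have "1 < \<tau>" by (simp add: \<tau>_def field_simps)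
  have "real d * \<tau> \<le> (real d + 1) * \<tau>" using \<open>1 < \<tau>\<close> by simp
  also have "\<dots> = \<delta>" by (simp add: \<tau>_def)
  finally have "real d * \<tau> \<le> \<delta>" .
  have dist: "\<delta> < real (hamming_rows n M i i')" if "i \<in> S" "i' \<in> S" "i \<noteq> i'" for i i'
    using far that by (auto simp: \<delta>_def C_def m_def not_le)
  then have sep: "separated M \<delta> {} {0..<n} S"
    by (simp add: separated_def hamming_rows_def)
  obtain s where s: "merge_sequence n s" "\<And>k. k \<le> 2 * n - 2 \<Longrightarrow> d_wide_division d M (s k)"
    using ord unfolding twin_ordered_def by blast
  have "m \<le> 2 ^ d + real d * 2 ^ d * (2 * real n / \<tau>)"
    using card_separated_le[OF s \<open>1 < \<tau>\<close> \<open>real d * \<tau> \<le> \<delta>\<close> _ _ S(1) sep] by (simp add: m_def)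
  also have "real d * 2 ^ d * (2 * real n / \<tau>) \<le> m / 2"
  proof -
    have n: "real n > 0" using m \<open>m \<le> real n\<close> by simp
    have "2 * real n / \<tau> = m / (2 * 2 ^ d * (real d + 1))"
      using m n by (simp add: \<tau>_def \<delta>_def C divide_simps)
    then have "real d * 2 ^ d * (2 * real n / \<tau>) = (real d / (real d + 1)) * (m / 2)"
      by simp
    also have "\<dots> \<le> 1 * (m / 2)" using m by (intro mult_right_mono) auto
    finally show ?thesis by simp
  qed
  finally have "m \<le> 2 * 2 ^ d" by simp
  also have "\<dots> \<le> C"
  proof -
    have "1 * 1 \<le> (real d + 1) * (real d + 1)" by (rule mult_mono) auto
    then have "2 ^ d * 1 \<le> 2 ^ d * ((real d + 1) * (real d + 1))"
      by (intro mult_left_mono) auto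
    moreover have "0 \<le> (2 ^ d :: real)" by simp
    ultimately show ?thesis unfolding C by (simp only: mult.assoc)
  qed
  finally have "m * real n \<le> C * real n" by (rule mult_right_mono) simp
  then have "real n \<le> \<delta>" using m by (simp add: \<delta>_def field_simps)
  obtain i i' where "i \<in> S" "i' \<in> S" "i \<noteq> i'"
    using S(2) card_le_Suc0_iff_eq[OF finite_subset[OF S(1)]] by fastforce
  then have "real n < real (hamming_rows n M i i')" using dist \<open>real n \<le> \<delta>\<close> by fastforce
  moreover have "hamming_rows n M i i' \<le> card {0..<n}"
    unfolding hamming_rows_def by (intro card_mono) auto
  ultimately show False by simp
qed

section \<open>Greedy Hamiltonian paths\<close>

fun path_length :: "('a \<Rightarrow> 'a \<Rightarrow> nat) \<Rightarrow> 'a list \<Rightarrow> nat" where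
  "path_length f (x # y # zs) = f x y + path_length f (y # zs)"
| "path_length f _ = 0"

text \<open>If \<open>c\<close> follows \<open>b\<close>, the edge from \<open>b\<close> to
  \<open>c\<close> gives way to edges through \<open>a\<close>, and
  \<open>f a c \<le> f a b + f b c\<close>. A prefix of two or more elements adds the same first
  edge on both sides.\<close>

lemma path_length_insert:
  assumes "\<And>x y. f x y = f y x" "\<And>x y z. f x z \<le> f x y + f y z"
  shows "path_length f (xs @ b # a # ys) \<le> path_length f (xs @ b # ys) + 2 * f a b"
proof (induction xs rule: induct_list012)
  case 1
  show ?case
  proof (cases ys)
    case (Cons c zs)
    then show ?thesis using assms(2)[of a c b] assms(1)[of a b] by simp
  qed (use assms(1)[of a b] in simp)
next
  case (2 x)
  show ?case
  proof (cases ys)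
    case (Cons c zs)
    then show ?thesis using assms(2)[of a c b] assms(1)[of a b] by simp
  qed (use assms(1)[of a b] in simp)
qed simp

lemma path_length_conv_sum:
  "path_length f xs = (\<Sum>i<length xs - 1. f (xs ! i) (xs ! Suc i))"
  by (induction f xs rule: path_length.induct) (simp_all add: sum.lessThan_Suc_shift del: sum.lessThan_Suc)

text \<open>This is \<open>ln t \<le> t - 1\<close> at \<open>t = m / (m + 1)\<close>; it makes the
  harmonic sum of insertion costs telescope.\<close>

lemma inverse_le_ln_diff:
  assumes "m \<ge> 1"
  shows "1 / (real m + 1) \<le> ln (real m + 1) - ln (real m)"
proof -
  have "ln (real m / (real m + 1)) \<le> real m / (real m + 1) - 1"
    using assms by (intro ln_le_minus_one) auto
  moreover have "ln (real m / (real m + 1)) = ln (real m) - ln (real m + 1)"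
    using assms by (intro ln_divide_pos) auto
  moreover have "real m / (real m + 1) - 1 = - (1 / (real m + 1))"
    by (simp add: field_simps)
  ultimately show ?thesis by linarith
qed

lemma short_path_exists:
  fixes f :: "'a \<Rightarrow> 'a \<Rightarrow> nat"
  assumes metric: "\<And>x y. f x y = f y x" "\<And>x y z. f x z \<le> f x y + f y z"
    and K: "K \<ge> 0"
    and close: "\<And>S. S \<subseteq> A \<Longrightarrow> card S \<ge> 2 \<Longrightarrow>
      \<exists>a\<in>S. \<exists>b\<in>S. a \<noteq> b \<and> real (f a b) \<le> K / real (card S)"
    and "B \<subseteq> A" "card B = Suc m"
  shows "\<exists>xs. distinct xs \<and> set xs = B \<and> real (path_length f xs) \<le> 2 * K * ln (real (Suc m))"
  using assms(5,6)
proof (induction m arbitrary: B)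
  case 0
  then obtain a where "B = {a}" by (auto simp: card_1_singleton_iff)
  then show ?case by (intro exI[of _ "[a]"]) simp
next
  case (Suc m)
  then obtain a b where ab: "a \<in> B" "b \<in> B" "a \<noteq> b"
    "real (f a b) \<le> K / real (card B)" using close[of B] by auto
  have "finite B" using Suc.prems by (metis card.infinite nat.distinct(1))
  then obtain xs where xs: "distinct xs" "set xs = B - {a}"
    "real (path_length f xs) \<le> 2 * K * ln (real (Suc m))"
    using Suc.IH[of "B - {a}"] Suc.prems ab by (auto simp: card_Diff_singleton)
  then have "b \<in> set xs" using ab by auto
  then obtain us vs where split: "xs = us @ b # vs" by (meson split_list)
  define ys where "ys = us @ b # a # vs"
  have "a \<notin> set xs" using xs by auto
  then have "distinct ys" "set ys = B" using xs ab split by (auto simp: ys_def)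
  have "path_length f ys \<le> path_length f xs + 2 * f a b"
    unfolding ys_def split by (rule path_length_insert[OF metric])
  then have "real (path_length f ys) \<le> real (path_length f xs) + 2 * real (f a b)" by linarith
  \<comment> \<open>Here \<open>card B = m + 2\<close>, written as \<open>real (Suc m) + 1\<close>
    to fit the logarithmic estimate.\<close>
  also have "\<dots> \<le> 2 * K * ln (real (Suc m)) + 2 * K * (1 / (real (Suc m) + 1))"
    using xs(3) ab(4) Suc.prems by (simp add: add.commute)
  also have "\<dots> \<le> 2 * K * ln (real (Suc m)) + 2 * K * (ln (real (Suc m) + 1) - ln (real (Suc m)))"
    using K by (intro add_left_mono mult_left_mono inverse_le_ln_diff) auto
  also have "\<dots> = 2 * K * ln (real (Suc (Suc m)))"
    by (simp add: algebra_simps)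
  finally show ?case using \<open>distinct ys\<close> \<open>set ys = B\<close> by blast
qed

section \<open>Hamming distances, permutations and coherence\<close>

lemma hamming_rows_commute: "hamming_rows n M i j = hamming_rows n M j i"
  unfolding hamming_rows_def by (rule arg_cong[where f = card]) auto

lemma hamming_rows_triangle:
  "hamming_rows n M i k \<le> hamming_rows n M i j + hamming_rows n M j k"
proof -
  have "hamming_rows n M i k
      \<le> card ({l. l < n \<and> M i l \<noteq> M j l} \<union> {l. l < n \<and> M j l \<noteq> M k l})"
    unfolding hamming_rows_def by (intro card_mono) auto
  also have "\<dots> \<le> hamming_rows n M i j + hamming_rows n M j k"
    unfolding hamming_rows_def by (rule card_Un_le)
  finally show ?thesis .
qed

text \<open>A column permutation only relabels coordinates: it maps one set of disagreements
  bijectively onto the other.\<close>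

lemma hamming_rows_permute:
  assumes "\<tau> permutes {0..<n}"
  shows "hamming_rows n (\<lambda>i j. M (\<sigma> i) (\<tau> j)) i i' = hamming_rows n M (\<sigma> i) (\<sigma> i')"
proof -
  have lt: "\<tau> j < n \<longleftrightarrow> j < n" for j
    using permutes_in_image[OF assms, of j] by simp
  have "{k. k < n \<and> M (\<sigma> i) k \<noteq> M (\<sigma> i') k}
      = \<tau> ` {k. k < n \<and> M (\<sigma> i) (\<tau> k) \<noteq> M (\<sigma> i') (\<tau> k)}"
  proof (intro set_eqI iffI)
    fix k assume k: "k \<in> {k. k < n \<and> M (\<sigma> i) k \<noteq> M (\<sigma> i') k}"
    obtain l where "k = \<tau> l" using permutes_surj[OF assms] by (metis surjD)
    then show "k \<in> \<tau> ` {k. k < n \<and> M (\<sigma> i) (\<tau> k) \<noteq> M (\<sigma> i') (\<tau> k)}" using k lt by auto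
  qed (use lt in auto)
  then show ?thesis
    unfolding hamming_rows_def
    by (simp add: card_image inj_on_subset[OF permutes_inj[OF assms]])
qed

lemma row_hamming_coherence_le:
  assumes "\<pi> permutes {0..<n}"
  shows "row_hamming_coherence n M \<le> row_hamming_sum n M \<pi>"
proof -
  have "finite ((\<lambda>\<pi>. row_hamming_sum n M \<pi>) ` {\<pi>. \<pi> permutes {0..<n}})"
    by (intro finite_imageI finite_permutations) simp
  then show ?thesis
    unfolding row_hamming_coherence_def using assms
    by (intro Min_le) (auto simp: image_def Collect_conj_eq conj_commute)
qed

lemma permutation_of_list:
  assumes "distinct xs" "set xs = {0..<n}"
  obtains \<pi> where "\<pi> permutes {0..<n}" "\<And>i. i < n \<Longrightarrow> \<pi> i = xs ! i"
proof -
  have len: "length xs = n" using distinct_card[OF assms(1)] assms(2) by simp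
  define \<pi> where "\<pi> i = (if i < n then xs ! i else i)" for i
  have "bij_betw ((!) xs) {0..<n} {0..<n}"
    using bij_betw_nth[OF assms(1), of "{0..<n}" "{0..<n}"] len assms(2)
    by (simp add: atLeast0LessThan)
  then have "bij_betw \<pi> {0..<n} {0..<n}"
    by (rule bij_betw_cong[THEN iffD1, rotated]) (simp add: \<pi>_def)
  then have "\<pi> permutes {0..<n}"
    by (rule bij_imp_permutes) (simp add: \<pi>_def)
  then show ?thesis using that[of \<pi>] by (simp add: \<pi>_def)
qed

text \<open>The short path is found in the reordered matrix; composing its order with \<sigma>
  orders the rows of \<open>M\<close> with the same sum.\<close>

lemma row_hamming_coherence_twin_ordered:
  assumes "n \<ge> 1" "\<sigma> permutes {0..<n}" "\<tau> permutes {0..<n}"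
    and ord: "twin_ordered d n (\<lambda>i j. M (\<sigma> i) (\<tau> j))"
  shows "real (row_hamming_coherence n M) \<le> 2 * packing_const d * real n * ln (real n)"
proof -
  define M' where "M' = (\<lambda>i j. M (\<sigma> i) (\<tau> j))"
  have "packing_const d * real n \<ge> 0" by (simp add: packing_const_def)
  moreover have "card {0..<n} = Suc (n - 1)" using assms(1) by simp
  moreover have "twin_ordered d n M'" using ord by (simp add: M'_def)
  ultimately obtain xs where xs: "distinct xs" "set xs = {0..<n}"
    "real (path_length (hamming_rows n M') xs)
      \<le> 2 * (packing_const d * real n) * ln (real (Suc (n - 1)))"
    using short_path_exists[OF hamming_rows_commute hamming_rows_triangle _ close_rows_exist subset_refl]
    by blast
  have len: "length xs = n" using distinct_card[OF xs(1)] xs(2) by simp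
  obtain \<pi> where \<pi>: "\<pi> permutes {0..<n}" "\<And>i. i < n \<Longrightarrow> \<pi> i = xs ! i"
    using permutation_of_list[OF xs(1,2)] by blast
  have "row_hamming_sum n M (\<sigma> \<circ> \<pi>) = path_length (hamming_rows n M') xs"
    unfolding row_hamming_sum_def path_length_conv_sum len M'_def
    by (intro sum.cong) (auto simp: \<pi>(2) hamming_rows_permute[OF assms(3)])
  moreover have "row_hamming_coherence n M \<le> row_hamming_sum n M (\<sigma> \<circ> \<pi>)"
    by (intro row_hamming_coherence_le permutes_compose \<pi>(1) assms(2))
  ultimately have "real (row_hamming_coherence n M) \<le> path_length (hamming_rows n M') xs"
    by simp
  then show ?thesis using xs(3) assms(1) by (simp add: mult.assoc)
qed

text \<open>By \<open>d + 1 \<le> 2 ^ d\<close> the left side is at most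
  \<open>2 ^ (3 * d + 3)\<close>, a single exponential. Bernoulli's inequality bounds this exponent
  by \<open>4 ^ (d + 1)\<close>, whence the factor 2 in the upper exponent.\<close>

lemma packing_const_le:
  "2 * packing_const d \<le> 2 powr (2 powr (2 * (real d + 1)))"
proof -
  have "Suc d \<le> 2 ^ d" by (simp add: Suc_leI)
  then have "real (Suc d) \<le> real (2 ^ d)" by (rule of_nat_mono)
  then have "real d + 1 \<le> 2 ^ d" by simp
  then have "(real d + 1)\<^sup>2 \<le> (2 ^ d)\<^sup>2" by (intro power_mono) auto
  then have "2 * packing_const d \<le> 2 * (2 ^ (d + 2) * (2 ^ d)\<^sup>2)"
    unfolding packing_const_def by (intro mult_left_mono) auto
  also have "\<dots> = 2 ^ (3 * d + 3)"
  proof -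
    have "3 * d + 3 = 1 + ((d + 2) + d * 2)" by simp
    then show ?thesis by (simp only: power_add power_mult power_one_right)
  qed
  also have "\<dots> = 2 powr (3 * (real d + 1))"
    by (subst powr_realpow[symmetric]) (auto simp: algebra_simps)
  also have "\<dots> \<le> 2 powr (2 powr (2 * (real d + 1)))"
  proof -
    have "1 + real (d + 1) * 3 \<le> (1 + 3 :: real) ^ (d + 1)"
      by (rule Bernoulli_inequality) simp
    also have "(1 + 3 :: real) ^ (d + 1) = 2 powr real (2 * (d + 1))"
      by (subst powr_realpow) (auto simp: power_mult)
    also have "real (2 * (d + 1)) = 2 * (real d + 1)" by simp
    finally show ?thesis by (intro powr_mono) auto
  qed
  finally show ?thesis .
qed

lemma ln_le_log2:
  assumes "x \<ge> 1"
  shows "ln x \<le> log 2 x"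
proof -
  have "ln x * ln 2 \<le> ln x * 1"
    using assms ln_le_minus_one[of 2] by (intro mult_left_mono) auto
  then show ?thesis by (simp add: log_def field_simps)
qed

theorem theorem3:
  shows "\<exists>c::real. \<forall>(n::nat) (M::bmatrix) (d::nat). twin_width n M = d \<longrightarrow>
     real (row_hamming_coherence n M) \<le> 2 powr (2 powr (c * (real d + 1))) * real n * log 2 (real n) \<and>
     real (col_hamming_coherence n M) \<le> 2 powr (2 powr (c * (real d + 1))) * real n * log 2 (real n)"
proof (intro exI[of _ 2] allI impI)
  fix n :: nat and M :: bmatrix and d :: nat
  assume d: "twin_width n M = d"
  define B where "B = 2 powr (2 powr (2 * (real d + 1))) * real n * log 2 (real n)"
  have "real (row_hamming_coherence n M) \<le> B \<and> real (col_hamming_coherence n M) \<le> B"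
  proof (cases "n = 0")
    case True
    \<comment> \<open>For \<open>n = 0\<close> there is no merge sequence, so
      \<open>twin_width\<close> carries no information; but both sides of the bound are 0.\<close>
    have "row_hamming_coherence 0 A = 0" for A
      using row_hamming_coherence_le[OF permutes_id, of 0 A] by (simp add: row_hamming_sum_def)
    then show ?thesis using True by (simp add: B_def col_hamming_coherence_def)
  next
    case False
    then have n: "n \<ge> 1" by simp
    obtain \<sigma> \<tau> where perm: "\<sigma> permutes {0..<n}" "\<tau> permutes {0..<n}"
      and ord: "twin_ordered d n (\<lambda>i j. M (\<sigma> i) (\<tau> j))"
      using twin_width_attained[OF n] d by metis
    \<comment> \<open>Transposition exchanges the roles of \<sigma> and \<tau>.\<close>
    have ord': "twin_ordered d n (\<lambda>i j. transp_mat M (\<tau> i) (\<sigma> j))"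
      using twin_ordered_transp[OF ord] by (simp add: transp_mat_def)
    have "2 * packing_const d * real n * ln (real n) \<le> B"
      unfolding B_def using n packing_const_le[of d] ln_le_log2[of "real n"]
      by (intro mult_mono mult_right_mono) auto
    then show ?thesis
      using row_hamming_coherence_twin_ordered[OF n perm ord]
        row_hamming_coherence_twin_ordered[OF n perm(2,1) ord']
      unfolding col_hamming_coherence_def by linarith
  qed
  then show "real (row_hamming_coherence n M)
        \<le> 2 powr (2 powr (2 * (real d + 1))) * real n * log 2 (real n) \<and>
      real (col_hamming_coherence n M)
        \<le> 2 powr (2 powr (2 * (real d + 1))) * real n * log 2 (real n)"
    by (simp add: B_def)
qed

end
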